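(* For all $n\geq2$: $\mathrm{LLPO}\leq_{\mathrm{sW}}\mathrm{RET}_n\equiv_{\mathrm{sW}}\mathrm{AUC}_n\leq_{\mathrm{sW}}\mathrm C_n$, and $\mathrm{RET}_n\leq_{\mathrm{sW}}\mathrm{RET}_{\mathbb N}\equiv_{\mathrm W}\mathrm{LPO}$.
   Context: A represented space is a set $X$ with a partial surjective map $\delta_X:\subseteq\mathbb N^{\mathbb N}\to X$. A problem is a partial multi-valued function $f:\subseteq X\rightrightarrows Y$ between represented spaces that has a realizer; a realizer of $f$ is a function $F:\subseteq\mathbb N^{\mathbb N}\to\mathbb N^{\mathbb N}$ with $\delta_YF(p)\in f\delta_X(p)$ for all $p\in\mathrm{dom}(f\delta_X)$. For $p,q\in\mathbb N^{\mathbb N}$, $\langle p,q\rangle(2n)=p(n)$, $\langle p,q\rangle(2n+1)=q(n)$. For problems $f,g$: $f\leq_{\mathrm W}g$ if there are computable $H,K:\subseteq\mathbb N^{\mathbb N}\to\mathbb N^{\mathbb N}$ such that $H\langle\mathrm{id},GK\rangle$ is a realizer of $f$ whenever $G$ is a realizer of $g$; $f\leq_{\mathrm{sW}}g$ is defined likewise with $HGK$ instead of $H\langle\mathrm{id},GK\rangle$. $\equiv_{\mathrm W},\equiv_{\mathrm{sW}}$ are the induced equivalences. $p-1\in\mathbb N^{\mathbb N}\cup\mathbb N^*$ denotes the finite or infinite concatenation of $p(0)-1,p(1)-1,\dots$, where $0-1$ is the empty word. For a represented space $X$, the completion $\overline X:=X\cup\{\bot\}$ ($\bot\notin X$) is represented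 by the total map $\delta_{\overline X}$ with $\delta_{\overline X}(p)=\delta_X(p-1)$ if $p-1\in\mathrm{dom}(\delta_X)$ and $\delta_{\overline X}(p)=\bot$ otherwise. Spaces $X\subseteq\mathbb N$ are represented by $p\mapsto p(0)$ (for $p(0)\in X$), $\mathbb N^{\mathbb N}$ by the identity. A number $n$ is identified with $\{0,\dots,n-1\}$. For a represented space $X$ the retraction problem is $\mathrm{RET}_X:\overline X\rightrightarrows X$, $x\mapsto\{y\in X:x\in X\Rightarrow x=y\}$. For $X\subseteq\mathbb N$: - $\mathrm C_X:\subseteq\mathbb N^{\mathbb N}\rightrightarrows X$, $p\mapsto X\setminus\mathrm{range}(p-1)$, with domain $\{p:|X\setminus\mathrm{range}(p-1)|\geq1\}$; $\mathrm{LLPO}:=\mathrm C_2$. - $\mathrm{AUC}_X:\subseteq\mathbb N^{\mathbb N}\rightrightarrows X$, $p\mapsto X\setminus\mathrm{range}(p-1)$, with domain $\{p:|X\setminus\mathrm{range}(p-1)|=1\text{ or }\mathrm{range}(p-1)=\emptyset\}$. - $\mathrm{LPO}:\mathbb N^{\mathbb N}\to\{0,1\}$, $\mathrm{LPO}(p)=1:\iff p=000\dots$. *)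

theory Defs
  imports Main "HOL-Library.Infinite_Set"
begin

type_synonym baire = "nat \<Rightarrow> nat"

text \<open>
  Partial recursive functionals: the usual schemes for partial recursive functions on
  tuples of numbers, extended by the basic function that reads the value of the infinite
  input \<open>p\<close> at a given position.
\<close>

datatype prog =
    Zero
  | Succ
  | Proj nat
  | Query
  | Comp prog "prog list"
  | PrimRec prog prog
  | Mu prog

fun run :: "prog \<Rightarrow> baire \<Rightarrow> nat list \<Rightarrow> nat option" where
  "run Zero p xs = Some 0"
| "run Succ p xs = (case xs of [x] \<Rightarrow> Some (Suc x) | _ \<Rightarrow> None)"
| "run (Proj i) p xs = (if i < length xs then Some (xs ! i) else None)"
| "run Query p xs = (case xs of [x] \<Rightarrow> Some (p x) | _ \<Rightarrow> None)"
| "run (Comp f gs) p xs = Option.bind (those (map (\<lambda>g. run g p xs) gs)) (run f p)"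
| "run (PrimRec f g) p xs =
     (case xs of
        [] \<Rightarrow> None
      | n # ys \<Rightarrow>
          rec_nat (run f p ys) (\<lambda>k r. Option.bind r (\<lambda>y. run g p (k # y # ys))) n)"
| "run (Mu f) p xs =
     (if \<exists>n. run f p (n # xs) = Some 0 \<and> (\<forall>m<n. run f p (m # xs) \<noteq> None)
      then Some (LEAST n. run f p (n # xs) = Some 0) else None)"

text \<open>
  A partial \<open>F\<close> is computable if one program produces the \<open>n\<close>-th entry of \<open>F p\<close> from \<open>p\<close>
  and \<open>n\<close>, for all \<open>p\<close> in the domain of \<open>F\<close>; nothing is required outside the domain.
\<close>

definition computable :: "(baire \<rightharpoonup> baire) \<Rightarrow> bool" where
  "computable F \<longleftrightarrow> (\<exists>e. \<forall>p q. F p = Some q \<longrightarrow> (\<forall>n. run e p [n] = Some (q n)))"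

definition pairing :: "baire \<Rightarrow> baire \<Rightarrow> baire" where
  "pairing p q = (\<lambda>k. if even k then p (k div 2) else q (k div 2))"

text \<open>
  A represented space is given by its representation; since representations are
  surjective, the underlying set is the range \<^term>\<open>ran \<delta>\<close>.
\<close>

type_synonym 'a rep = "baire \<rightharpoonup> 'a"

text \<open>
  A partial multi-valued function is a set-valued function \<open>vals\<close>, whose domain consists
  of the points at which the set of values is nonempty.
\<close>

record ('a, 'b) problem =
  src :: "'a rep"
  tgt :: "'b rep"
  vals :: "'a \<Rightarrow> 'b set"

definition realizer :: "('a, 'b) problem \<Rightarrow> (baire \<rightharpoonup> baire) \<Rightarrow> bool" where
  "realizer f F \<longleftrightarrow>
     (\<forall>p x. src f p = Some x \<and> vals f x \<noteq> {} \<longrightarrow>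
        (\<exists>q y. F p = Some q \<and> tgt f q = Some y \<and> y \<in> vals f x))"

definition is_problem :: "('a, 'b) problem \<Rightarrow> bool" where
  "is_problem f \<longleftrightarrow>
     {x. vals f x \<noteq> {}} \<subseteq> ran (src f) \<and> (\<forall>x. vals f x \<subseteq> ran (tgt f)) \<and> (\<exists>F. realizer f F)"

definition W_le :: "('a, 'b) problem \<Rightarrow> ('c, 'd) problem \<Rightarrow> bool" (infix "\<le>\<^sub>W" 50) where
  "f \<le>\<^sub>W g \<longleftrightarrow>
     (\<exists>H K. computable H \<and> computable K \<and>
        (\<forall>G. realizer g G \<longrightarrow>
           realizer f (\<lambda>p. Option.bind (Option.bind (K p) G) (\<lambda>r. H (pairing p r)))))"

definition sW_le :: "('a, 'b) problem \<Rightarrow> ('c, 'd) problem \<Rightarrow> bool" (infix "\<le>\<^sub>s\<^sub>W" 50) where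
  "f \<le>\<^sub>s\<^sub>W g \<longleftrightarrow>
     (\<exists>H K. computable H \<and> computable K \<and>
        (\<forall>G. realizer g G \<longrightarrow> realizer f (\<lambda>p. Option.bind (Option.bind (K p) G) H)))"

definition W_eq :: "('a, 'b) problem \<Rightarrow> ('c, 'd) problem \<Rightarrow> bool" (infix "\<equiv>\<^sub>W" 50) where
  "f \<equiv>\<^sub>W g \<longleftrightarrow> f \<le>\<^sub>W g \<and> g \<le>\<^sub>W f"

definition sW_eq :: "('a, 'b) problem \<Rightarrow> ('c, 'd) problem \<Rightarrow> bool" (infix "\<equiv>\<^sub>s\<^sub>W" 50) where
  "f \<equiv>\<^sub>s\<^sub>W g \<longleftrightarrow> f \<le>\<^sub>s\<^sub>W g \<and> g \<le>\<^sub>s\<^sub>W f"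

text \<open>
  \<open>p - 1\<close>: drop all zeros of \<open>p\<close> and decrease the remaining entries by one.  The result
  is either a finite word (\<open>Inl\<close>) or an infinite sequence (\<open>Inr\<close>).
\<close>

definition minus_one :: "baire \<Rightarrow> nat list + baire" where
  "minus_one p =
     (let A = {i. p i \<noteq> 0} in
      if finite A then Inl (map (\<lambda>i. p i - 1) (sorted_list_of_set A))
      else Inr (\<lambda>k. p (enumerate A k) - 1))"

definition range_minus_one :: "baire \<Rightarrow> nat set" where
  "range_minus_one p = (case minus_one p of Inl w \<Rightarrow> set w | Inr q \<Rightarrow> range q)"

text \<open>In the completion, \<open>None\<close> plays the role of the new point \<open>\<bottom>\<close>.\<close>

definition completion :: "'a rep \<Rightarrow> 'a option rep" where
  "completion \<delta> = (\<lambda>p. Some (case minus_one p of Inl w \<Rightarrow> None | Inr q \<Rightarrow> \<delta> q))"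

definition baire_space :: "baire rep" where
  "baire_space = Some"

definition nat_space :: "nat set \<Rightarrow> nat rep" where
  "nat_space X = (\<lambda>p. if p 0 \<in> X then Some (p 0) else None)"

definition RET :: "'a rep \<Rightarrow> ('a option, 'a) problem" where
  "RET \<delta> = \<lparr>src = completion \<delta>, tgt = \<delta>,
            vals = (\<lambda>x. {y \<in> ran \<delta>. \<forall>x'. x = Some x' \<longrightarrow> x' = y})\<rparr>"

text \<open>The set of values is nonempty precisely for \<open>p\<close> in the domain of the choice problem.\<close>

definition Choice :: "nat set \<Rightarrow> (baire, nat) problem" where
  "Choice X = \<lparr>src = baire_space, tgt = nat_space X, vals = (\<lambda>p. X - range_minus_one p)\<rparr>"

definition AUC :: "nat set \<Rightarrow> (baire, nat) problem" where
  "AUC X = \<lparr>src = baire_space, tgt = nat_space X,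
            vals = (\<lambda>p. if card (X - range_minus_one p) = 1 \<or> range_minus_one p = {}
                        then X - range_minus_one p else {})\<rparr>"

definition LLPO :: "(baire, nat) problem" where
  "LLPO = Choice {..<2}"

definition LPO :: "(baire, nat) problem" where
  "LPO = \<lparr>src = baire_space, tgt = nat_space {0, 1},
          vals = (\<lambda>p. {if \<forall>i. p i = 0 then 1 else 0})\<rparr>"

lemma range_minus_one_iff: "k \<in> range_minus_one p \<longleftrightarrow> (\<exists>i. p i = Suc k)"
proof -
  have key: "k \<in> (\<lambda>i. p i - 1) ` {i. p i \<noteq> 0} \<longleftrightarrow> (\<exists>i. p i = Suc k)"
    unfolding image_iff by (metis (mono_tags) Suc_pred diff_Suc_1 mem_Collect_eq nat.distinct(1) not_gr_zero)
  show ?thesis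
  proof (cases "finite {i. p i \<noteq> 0}")
    case True
    then have "range_minus_one p = (\<lambda>i. p i - 1) ` {i. p i \<noteq> 0}"
      by (simp add: range_minus_one_def minus_one_def)
    with key show ?thesis by simp
  next
    case False
    then have "range (enumerate {i. p i \<noteq> 0}) = {i. p i \<noteq> 0}"
      by (simp add: range_enumerate)
    then have "range (\<lambda>j. p (enumerate {i. p i \<noteq> 0} j) - 1) = (\<lambda>i. p i - 1) ` {i. p i \<noteq> 0}"
      using image_image[of "\<lambda>i. p i - 1" "enumerate {i. p i \<noteq> 0}" UNIV] by simp
    with False have "range_minus_one p = (\<lambda>i. p i - 1) ` {i. p i \<noteq> 0}"
      by (simp add: range_minus_one_def minus_one_def)
    with key show ?thesis by simp
  qed
qed

lemma minus_one_Suc: "minus_one (\<lambda>i. Suc (q i)) = Inr q"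
proof -
  have "enumerate (UNIV :: nat set) k = k" for k
  proof (induction k)
    case 0
    show ?case by (simp add: enumerate_0)
  next
    case (Suc k)
    have "(LEAST s. k < s) = Suc k"
      by (rule Least_equality) auto
    with Suc show ?case by (simp add: enumerate_Suc'')
  qed
  then show ?thesis
    by (simp add: minus_one_def)
qed

lemma ran_baire_space: "ran baire_space = UNIV"
  by (auto simp: baire_space_def ran_def)

lemma ran_nat_space: "ran (nat_space X) = X"
proof -
  have "\<exists>p. nat_space X p = Some x" if "x \<in> X" for x
    using that by (intro exI[of _ "\<lambda>_. x"]) (simp add: nat_space_def)
  then show ?thesis
    by (auto simp: ran_def nat_space_def split: if_splits)
qed

lemma ran_completion: "ran (completion \<delta>) = insert None (Some ` ran \<delta>)"
proof
  show "ran (completion \<delta>) \<subseteq> insert None (Some ` ran \<delta>)"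
  proof
    fix z assume "z \<in> ran (completion \<delta>)"
    then obtain p where "completion \<delta> p = Some z"
      by (auto simp: ran_def)
    then show "z \<in> insert None (Some ` ran \<delta>)"
      by (cases "minus_one p"; cases z) (auto simp: completion_def intro: ranI)
  qed
  have "completion \<delta> (\<lambda>_. 0) = Some None"
    by (simp add: completion_def minus_one_def)
  moreover have "completion \<delta> (\<lambda>i. Suc (q i)) = Some (Some x)" if "\<delta> q = Some x" for q x
    using that by (simp add: completion_def minus_one_Suc)
  ultimately show "insert None (Some ` ran \<delta>) \<subseteq> ran (completion \<delta>)"
    by (force simp: ran_def)
qed

lemma is_problemI:
  assumes "{x. vals f x \<noteq> {}} \<subseteq> ran (src f)" "\<And>x. vals f x \<subseteq> ran (tgt f)"
  shows "is_problem f"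
proof -
  define F where
    "F p = Some (SOME q. \<exists>y. tgt f q = Some y \<and> y \<in> vals f (the (src f p)))" for p
  have "\<exists>q y. F p = Some q \<and> tgt f q = Some y \<and> y \<in> vals f x"
    if "src f p = Some x" "vals f x \<noteq> {}" for p x
  proof -
    from that(2) assms(2)[of x] have "\<exists>q y. tgt f q = Some y \<and> y \<in> vals f x"
      by (force simp: ran_def)
    from someI_ex[OF this] show ?thesis
      using that(1) by (auto simp: F_def)
  qed
  then show ?thesis
    unfolding is_problem_def realizer_def using assms by blast
qed

lemma is_problem_RET: "is_problem (RET \<delta>)"
proof (rule is_problemI)
  show "{x. vals (RET \<delta>) x \<noteq> {}} \<subseteq> ran (src (RET \<delta>))"
  proof
    fix x assume "x \<in> {x. vals (RET \<delta>) x \<noteq> {}}"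
    then show "x \<in> ran (src (RET \<delta>))"
      by (cases x) (auto simp: RET_def ran_completion)
  qed
qed (auto simp: RET_def)

lemma is_problem_Choice: "is_problem (Choice X)"
  by (rule is_problemI) (auto simp: Choice_def ran_baire_space ran_nat_space)

lemma is_problem_AUC: "is_problem (AUC X)"
  by (rule is_problemI) (auto simp: AUC_def ran_baire_space ran_nat_space)

lemma is_problem_LPO: "is_problem LPO"
  by (rule is_problemI) (auto simp: LPO_def ran_baire_space ran_nat_space)

end

theory Submission
  imports Defs
begin

text \<open>
  A name of a point \<open>y\<close> of a completion may stay silent (output \<open>0\<close>) for as long as it likes, and
  silence forever is a name of \<open>\<bottom>\<close>.  So, to answer choice questions by a retraction, stay silent
  until all candidates but one have been excluded and then repeat the remaining one; if this never
  happens, every candidate is a correct answer.  Conversely, once a name of a point of \<open>n\<close> breaks its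
  silence, all other candidates can be excluded.  For \<open>LPO\<close>, stay silent until the
  first nonzero entry and then name its position \<open>j\<close>; whatever \<open>j\<close> the retraction returns, \<open>p j\<close>
  decides whether \<open>p\<close> is zero.  In the other direction, \<open>LPO\<close> tells whether the search for the first
  nonzero entry of a name terminates.
\<close>

section \<open>Closure properties of oracle-recursive functions\<close>

text \<open>Only total functionals are considered, so composition and primitive recursion carry no
  definedness conditions; partiality enters only through \<open>computable_search\<close>.\<close>

definition recursive :: "nat \<Rightarrow> (baire \<Rightarrow> nat list \<Rightarrow> nat) \<Rightarrow> bool" where
  "recursive k f \<longleftrightarrow> (\<exists>e. \<forall>p xs. length xs = k \<longrightarrow> run e p xs = Some (f p xs))"

definition decidable :: "nat \<Rightarrow> (baire \<Rightarrow> nat list \<Rightarrow> bool) \<Rightarrow> bool" where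
  "decidable k P \<longleftrightarrow> recursive k (\<lambda>p xs. of_bool (P p xs))"

lemma recursive_cong:
  assumes "\<And>p xs. length xs = k \<Longrightarrow> f p xs = g p xs"
  shows "recursive k f \<longleftrightarrow> recursive k g"
  using assms by (simp add: recursive_def)

lemma those_map_Some:
  "(\<And>x. x \<in> set xs \<Longrightarrow> f x = Some (g x)) \<Longrightarrow> those (map f xs) = Some (map g xs)"
  by (induction xs) auto

lemma recursive_comp:
  assumes "recursive (length gs) f" and "\<And>g. g \<in> set gs \<Longrightarrow> recursive k g"
  shows "recursive k (\<lambda>p xs. f p (map (\<lambda>g. g p xs) gs))"
proof -
  obtain e where e: "\<And>p xs. length xs = length gs \<Longrightarrow> run e p xs = Some (f p xs)"
    using assms(1) by (auto simp: recursive_def)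
  have "\<forall>g\<in>set gs. \<exists>d. \<forall>p xs. length xs = k \<longrightarrow> run d p xs = Some (g p xs)"
    using assms(2) by (simp add: recursive_def)
  then obtain d where d: "\<And>g p xs. g \<in> set gs \<Longrightarrow> length xs = k \<Longrightarrow> run (d g) p xs = Some (g p xs)"
    by metis
  have "run (Comp e (map d gs)) p xs = Some (f p (map (\<lambda>g. g p xs) gs))" if "length xs = k" for p xs
  proof -
    have "those (map (\<lambda>g. run (d g) p xs) gs) = Some (map (\<lambda>g. g p xs) gs)"
      using d that by (intro those_map_Some) blast
    then show ?thesis by (simp add: e comp_def)
  qed
  then show ?thesis unfolding recursive_def by blast
qed

lemma recursive_nth: "i < k \<Longrightarrow> recursive k (\<lambda>p xs. xs ! i)"
  unfolding recursive_def by (rule exI[of _ "Proj i"]) simp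

lemma recursive_nth_tl: "Suc i < k \<Longrightarrow> recursive k (\<lambda>p xs. tl xs ! i)"
  using recursive_nth[of "Suc i" k] by (subst recursive_cong) (simp_all add: nth_tl)

lemma recursive_nth_tl_tl: "Suc (Suc i) < k \<Longrightarrow> recursive k (\<lambda>p xs. tl (tl xs) ! i)"
  using recursive_nth[of "Suc (Suc i)" k] by (subst recursive_cong) (simp_all add: nth_tl)

lemma recursive_Suc:
  assumes "recursive k f"
  shows "recursive k (\<lambda>p xs. Suc (f p xs))"
proof -
  have "recursive 1 (\<lambda>p xs. Suc (xs ! 0))"
    unfolding recursive_def
    by (rule exI[of _ Succ]) (auto simp: length_Suc_conv)
  from recursive_comp[of "[f]", simplified, OF this[simplified] assms] show ?thesis by simp
qed

lemma recursive_oracle: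
  assumes "recursive k f"
  shows "recursive k (\<lambda>p xs. p (f p xs))"
proof -
  have "recursive 1 (\<lambda>p xs. p (xs ! 0))"
    unfolding recursive_def
    by (rule exI[of _ Query]) (auto simp: length_Suc_conv)
  from recursive_comp[of "[f]", simplified, OF this[simplified] assms] show ?thesis by simp
qed

lemma recursive_const: "recursive k (\<lambda>p xs. c)"
proof (induction c)
  case 0
  show ?case unfolding recursive_def by (rule exI[of _ Zero]) simp
qed (rule recursive_Suc)

text \<open>The first \<open>m\<close> arguments are traded for the values of \<open>gs\<close>.
  This serves to insert an argument in front, to drop arguments, and to keep the counter of a
  recursion while forgetting its accumulator.\<close>

lemma recursive_subst:
  assumes "recursive (length gs + k) f" and "\<And>g. g \<in> set gs \<Longrightarrow> recursive (m + k) g"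
  shows "recursive (m + k) (\<lambda>p xs. f p (map (\<lambda>g. g p xs) gs @ drop m xs))"
proof -
  let ?hs = "gs @ map (\<lambda>i p xs. xs ! i) [m..<m + k]"
  have "recursive (m + k) (\<lambda>p xs. f p (map (\<lambda>g. g p xs) ?hs))"
    using assms by (intro recursive_comp) (auto intro: recursive_nth)
  moreover have "map (\<lambda>g. g p xs) ?hs = map (\<lambda>g. g p xs) gs @ drop m xs"
    if "length xs = m + k" for p and xs :: "nat list"
    using that by (auto intro!: nth_equalityI simp: nth_append)
  ultimately show ?thesis by (subst recursive_cong) simp_all
qed

lemma recursive_rec_nat:
  assumes "recursive k h" "recursive k f"
    and "recursive (Suc (Suc k)) (\<lambda>p ys. g p (ys ! 0) (ys ! 1) (tl (tl ys)))"
  shows "recursive k (\<lambda>p xs. rec_nat (f p xs) (\<lambda>i r. g p i r xs) (h p xs))"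
proof -
  obtain ef where ef: "\<And>p xs. length xs = k \<Longrightarrow> run ef p xs = Some (f p xs)"
    using assms(2) by (auto simp: recursive_def)
  obtain eg where eg: "\<And>p ys. length ys = Suc (Suc k) \<Longrightarrow>
      run eg p ys = Some (g p (ys ! 0) (ys ! 1) (tl (tl ys)))"
    using assms(3) by (auto simp: recursive_def)
  let ?R = "\<lambda>p ys. rec_nat (f p (tl ys)) (\<lambda>i r. g p i r (tl ys)) (ys ! 0)"
  have "run (PrimRec ef eg) p ys = Some (?R p ys)" if ys: "length ys = Suc k" for p ys
  proof -
    obtain n xs where [simp]: "ys = n # xs" "length xs = k"
      using ys by (auto simp: length_Suc_conv)
    have "rec_nat (run ef p xs) (\<lambda>k r. Option.bind r (\<lambda>y. run eg p (k # y # xs))) n = Some (?R p ys)"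
      by (simp, induction n) (simp_all add: ef eg)
    then show ?thesis by simp
  qed
  then have "recursive (Suc k) ?R" unfolding recursive_def by blast
  from recursive_subst[of "[h]" k _ 0, simplified, OF this assms(1)] show ?thesis by simp
qed

lemma recursive_weaken2:
  "recursive k f \<Longrightarrow> recursive (Suc (Suc k)) (\<lambda>p xs. f p (tl (tl xs)))"
  using recursive_subst[of "[]" k f 2] by (simp add: drop_Suc eval_nat_numeral)

text \<open>A recursion of length 0 or 1: it starts at the else-value, and a single step overwrites
  it with the then-value.\<close>

lemma recursive_If:
  assumes "decidable k P" "recursive k f" "recursive k g"
  shows "recursive k (\<lambda>p xs. if P p xs then f p xs else g p xs)"
proof -
  have "recursive k (\<lambda>p xs. rec_nat (g p xs) (\<lambda>i r. f p xs) (of_bool (P p xs)))"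
    using assms by (intro recursive_rec_nat recursive_weaken2) (simp_all add: decidable_def)
  then show ?thesis by (rule iffD1[OF recursive_cong, rotated]) simp
qed

lemma recursive_pred:
  assumes "recursive k f"
  shows "recursive k (\<lambda>p xs. f p xs - 1)"
proof -
  have "recursive k (\<lambda>p xs. rec_nat 0 (\<lambda>i r. i) (f p xs))"
    by (intro recursive_rec_nat recursive_const recursive_nth assms) simp
  moreover have "rec_nat 0 (\<lambda>i r. i) n = n - 1" for n :: nat
    by (cases n) simp_all
  ultimately show ?thesis by simp
qed

lemma recursive_diff:
  assumes "recursive k f" "recursive k g"
  shows "recursive k (\<lambda>p xs. f p xs - g p xs)"
proof -
  have "recursive k (\<lambda>p xs. rec_nat (f p xs) (\<lambda>i r. r - 1) (g p xs))"
    by (intro recursive_rec_nat recursive_pred recursive_nth assms) simp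
  moreover have "rec_nat m (\<lambda>i r. r - 1) n = m - n" for m n :: nat
    by (induction n) simp_all
  ultimately show ?thesis by simp
qed

lemma recursive_double:
  assumes "recursive k f"
  shows "recursive k (\<lambda>p xs. 2 * f p xs)"
proof -
  have "recursive k (\<lambda>p xs. rec_nat 0 (\<lambda>i r. Suc (Suc r)) (f p xs))"
    by (intro recursive_rec_nat recursive_Suc recursive_const recursive_nth assms) simp
  moreover have "rec_nat 0 (\<lambda>i r. Suc (Suc r)) n = 2 * n" for n :: nat
    by (induction n) simp_all
  ultimately show ?thesis by simp
qed

section \<open>Decidable predicates and bounded quantifiers\<close>

lemma decidable_not:
  assumes "decidable k P"
  shows "decidable k (\<lambda>p xs. \<not> P p xs)"
  unfolding decidable_def of_bool_def
  using recursive_If[OF assms recursive_const[of k 0] recursive_const[of k 1]]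
  by (rule iffD1[OF recursive_cong, rotated]) simp

lemma decidable_conj:
  assumes "decidable k P" "decidable k Q"
  shows "decidable k (\<lambda>p xs. P p xs \<and> Q p xs)"
  unfolding decidable_def of_bool_def
  using recursive_If[OF assms(1) assms(2)[unfolded decidable_def] recursive_const[of k 0]]
  by (rule iffD1[OF recursive_cong, rotated]) simp

lemma decidable_disj:
  assumes "decidable k P" "decidable k Q"
  shows "decidable k (\<lambda>p xs. P p xs \<or> Q p xs)"
  using decidable_not[OF decidable_conj[OF assms[THEN decidable_not]]] by simp

text \<open>Truncated subtraction makes \<open>1 - (f - g)\<close> the indicator.\<close>

lemma decidable_le:
  assumes "recursive k f" "recursive k g"
  shows "decidable k (\<lambda>p xs. f p xs \<le> g p xs)"
  unfolding decidable_def
  using recursive_diff[OF recursive_const[of k 1] recursive_diff[OF assms]]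
  by (rule iffD1[OF recursive_cong, rotated]) simp

lemma decidable_eq:
  assumes "recursive k f" "recursive k g"
  shows "decidable k (\<lambda>p xs. f p xs = g p xs)"
  using decidable_conj[OF decidable_le[OF assms] decidable_le[OF assms(2,1)]]
  by (simp add: order_eq_iff)

lemma decidable_less:
  assumes "recursive k f" "recursive k g"
  shows "decidable k (\<lambda>p xs. f p xs < g p xs)"
  using decidable_not[OF decidable_le[OF assms(2,1)]] by (simp add: not_le)

lemma decidable_ex_less:
  assumes "recursive k h" "decidable (Suc k) (\<lambda>p ys. P p (ys ! 0) (tl ys))"
  shows "decidable k (\<lambda>p xs. \<exists>j < h p xs. P p j xs)"
proof -
  \<comment> \<open>The step of the recursion also receives the previous flag, between the counter
    and the parameters; the substitution makes \<open>P\<close> ignore it.\<close>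
  have "decidable (Suc (Suc k)) (\<lambda>p ys. P p (ys ! 0) (tl (tl ys)))"
    using recursive_subst[of "[\<lambda>p ys. ys ! 0]" k "\<lambda>p ys. of_bool (P p (ys ! 0) (tl ys))" 2] assms(2)
    by (simp add: decidable_def drop_Suc eval_nat_numeral recursive_nth)
  then have "recursive k (\<lambda>p xs. rec_nat 0 (\<lambda>j r. if P p j xs then 1 else r) (h p xs))"
    using assms(1) by (intro recursive_rec_nat recursive_If recursive_const recursive_nth) simp_all
  moreover have "rec_nat 0 (\<lambda>j r. if Q j then 1 else r) n = (of_bool (\<exists>j<n. Q j) :: nat)"
    for n and Q :: "nat \<Rightarrow> bool"
    by (induction n) (auto simp: less_Suc_eq)
  ultimately show ?thesis by (simp add: decidable_def)
qed

lemma decidable_all_less: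
  assumes "recursive k h" "decidable (Suc k) (\<lambda>p ys. P p (ys ! 0) (tl ys))"
  shows "decidable k (\<lambda>p xs. \<forall>j < h p xs. P p j xs)"
  using decidable_not[OF decidable_ex_less[OF assms(1) decidable_not[OF assms(2)]]] by simp

lemma recursive_mod:
  assumes "0 < n" "recursive k f"
  shows "recursive k (\<lambda>p xs. f p xs mod n)"
proof -
  have "recursive k (\<lambda>p xs. rec_nat 0 (\<lambda>i r. if Suc r = n then 0 else Suc r) (f p xs))"
    by (intro recursive_rec_nat recursive_If decidable_eq recursive_Suc recursive_const
        recursive_nth assms(2)) simp_all
  moreover have "rec_nat 0 (\<lambda>i r. if Suc r = n then 0 else Suc r) m = m mod n" for m
    using assms(1) by (induction m) (simp_all add: mod_Suc)
  ultimately show ?thesis by simp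
qed

lemmas recursive_intros =
  recursive_nth recursive_nth_tl recursive_nth_tl_tl recursive_Suc recursive_oracle
  recursive_const recursive_If recursive_pred recursive_double recursive_mod
  decidable_not decidable_disj decidable_eq decidable_less
  decidable_ex_less decidable_all_less

section \<open>From recursive functions to computable functionals\<close>

lemma computableI:
  assumes "recursive 1 (\<lambda>p xs. f p (xs ! 0))"
  shows "computable (\<lambda>p. Some (f p))"
proof -
  obtain e where "\<And>p xs. length xs = 1 \<Longrightarrow> run e p xs = Some (f p (xs ! 0))"
    using assms by (auto simp: recursive_def)
  then have "\<forall>p n. run e p [n] = Some (f p n)" by simp
  then show ?thesis unfolding computable_def by auto
qed

text \<open>\<open>Mu\<close> is undefined when the search fails, which \<open>computable\<close>
  permits outside the domain. A constant output suffices because a number is read from the first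
  entry of its name alone.\<close>

lemma computable_search:
  assumes "decidable 1 (\<lambda>p xs. P p (xs ! 0))" "recursive 1 (\<lambda>p xs. f p (xs ! 0))"
  shows "computable (\<lambda>p. if \<exists>i. P p i then Some (\<lambda>_. f p (LEAST i. P p i)) else None)"
proof -
  have "recursive 1 (\<lambda>p xs. of_bool (\<not> P p (xs ! 0)))"
    using decidable_not[OF assms(1)] by (simp add: decidable_def)
  \<comment> \<open>\<open>Mu\<close> puts the search variable in front of the requested output
    position, so the test gets a second argument that it ignores.\<close>
  then have "recursive 2 (\<lambda>p xs. of_bool (\<not> P p (xs ! 0)))"
    using recursive_comp[of "[\<lambda>p xs. xs ! 0]" "\<lambda>p xs. of_bool (\<not> P p (xs ! 0))" 2]
    by (simp add: recursive_nth)
  then obtain d where d: "\<And>p xs. length xs = 2 \<Longrightarrow> run d p xs = Some (of_bool (\<not> P p (xs ! 0)))"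
    by (auto simp: recursive_def)
  obtain e where e: "\<And>p xs. length xs = 1 \<Longrightarrow> run e p xs = Some (f p (xs ! 0))"
    using assms(2) by (auto simp: recursive_def)
  have "run (Comp e [Mu d]) p [n] = Some (f p (LEAST i. P p i))" if "\<exists>i. P p i" for p n
    using that by (simp add: d e)
  then show ?thesis
    unfolding computable_def by (intro exI[of _ "Comp e [Mu d]"]) (auto split: if_splits)
qed

lemma computable_id: "computable Some"
  by (rule computableI) (intro recursive_intros, simp)

section \<open>The reductions\<close>

text \<open>All that is known about a realizer of \<open>g\<close> is that at \<open>K p\<close> it
  returns some name of some solution, so \<open>H\<close> is tested against every such name.\<close>

lemma sW_leI:
  assumes "computable (\<lambda>r. Some (H r))" "computable (\<lambda>p. Some (K p))"
    and "\<And>p x. src f p = Some x \<Longrightarrow> vals f x \<noteq> {} \<Longrightarrow>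
      \<exists>x'. src g (K p) = Some x' \<and> vals g x' \<noteq> {} \<and>
        (\<forall>r y. tgt g r = Some y \<and> y \<in> vals g x' \<longrightarrow>
           (\<exists>z. tgt f (H r) = Some z \<and> z \<in> vals f x))"
  shows "f \<le>\<^sub>s\<^sub>W g"
  unfolding sW_le_def
proof (intro exI conjI allI impI)
  fix G assume G: "realizer g G"
  show "realizer f (\<lambda>p. Option.bind (Option.bind (Some (K p)) G) (\<lambda>r. Some (H r)))"
    unfolding realizer_def
  proof (intro allI impI)
    fix p x assume "src f p = Some x \<and> vals f x \<noteq> {}"
    then obtain x' where x': "src g (K p) = Some x'" "vals g x' \<noteq> {}"
      "\<And>r y. tgt g r = Some y \<Longrightarrow> y \<in> vals g x' \<Longrightarrow> \<exists>z. tgt f (H r) = Some z \<and> z \<in> vals f x"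
      using assms(3) by meson
    obtain r y where "G (K p) = Some r" "tgt g r = Some y" "y \<in> vals g x'"
      using G x'(1,2) unfolding realizer_def by blast
    then show "\<exists>q y. Option.bind (Option.bind (Some (K p)) G) (\<lambda>r. Some (H r)) = Some q \<and>
        tgt f q = Some y \<and> y \<in> vals f x"
      using x'(3) by simp
  qed
qed fact+

lemma W_leI:
  assumes "computable H" "computable (\<lambda>p. Some (K p))"
    and "\<And>p x. src f p = Some x \<Longrightarrow> vals f x \<noteq> {} \<Longrightarrow>
      \<exists>x'. src g (K p) = Some x' \<and> vals g x' \<noteq> {} \<and>
        (\<forall>r y. tgt g r = Some y \<and> y \<in> vals g x' \<longrightarrow>
           (\<exists>q z. H (pairing p r) = Some q \<and> tgt f q = Some z \<and> z \<in> vals f x))"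
  shows "f \<le>\<^sub>W g"
  unfolding W_le_def
proof (intro exI conjI allI impI)
  fix G assume G: "realizer g G"
  show "realizer f (\<lambda>p. Option.bind (Option.bind (Some (K p)) G) (\<lambda>r. H (pairing p r)))"
    unfolding realizer_def
  proof (intro allI impI)
    fix p x assume "src f p = Some x \<and> vals f x \<noteq> {}"
    then obtain x' where x': "src g (K p) = Some x'" "vals g x' \<noteq> {}"
      "\<And>r y. tgt g r = Some y \<Longrightarrow> y \<in> vals g x' \<Longrightarrow>
        \<exists>q z. H (pairing p r) = Some q \<and> tgt f q = Some z \<and> z \<in> vals f x"
      using assms(3) by meson
    obtain r y where "G (K p) = Some r" "tgt g r = Some y" "y \<in> vals g x'"
      using G x'(1,2) unfolding realizer_def by blast
    then show "\<exists>q y. Option.bind (Option.bind (Some (K p)) G) (\<lambda>r. H (pairing p r)) = Some q \<and>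
        tgt f q = Some y \<and> y \<in> vals f x"
      using x'(3) by simp
  qed
qed fact+

section \<open>Names of points in completions\<close>

lemma pairing_simps [simp]:
  "pairing p q (2 * i) = p i" "pairing p q (Suc 0) = q 0"
  by (simp_all add: pairing_def)

lemma nat_space_eq_Some: "nat_space X p = Some y \<longleftrightarrow> p 0 = y \<and> y \<in> X"
  by (auto simp: nat_space_def)

text \<open>The representation reads only the first letter of \<open>p - 1\<close>, which is the
  first nonzero entry decreased by one; a finite word \<open>p - 1\<close> is outside its domain,
  whatever its first letter.\<close>

lemma completion_nat_space:
  "completion (nat_space X) p =
    Some (if infinite {i. p i \<noteq> 0} \<and> p (LEAST i. p i \<noteq> 0) - 1 \<in> X
          then Some (p (LEAST i. p i \<noteq> 0) - 1) else None)"
  by (simp add: completion_def minus_one_def nat_space_def enumerate_0 Let_def)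

lemma completion_zero: "(\<And>i. p i = 0) \<Longrightarrow> completion \<delta> p = Some None"
  by (simp add: completion_def minus_one_def)

lemma completion_single_value:
  assumes "infinite {i. p i \<noteq> 0}" "\<And>i. p i \<noteq> 0 \<Longrightarrow> p i = Suc y" "y \<in> X"
  shows "completion (nat_space X) p = Some (Some y)"
proof -
  obtain i where "p i \<noteq> 0" using assms(1) by (metis (mono_tags, lifting) empty_Collect_eq finite.emptyI)
  then have "p (LEAST i. p i \<noteq> 0) \<noteq> 0" by (rule LeastI)
  then have "p (LEAST i. p i \<noteq> 0) = Suc y" by (rule assms(2))
  then show ?thesis using assms(1,3) by (simp add: completion_nat_space del: neq0_conv)
qed

lemma infinite_recurrent:
  assumes "\<And>k. \<exists>i\<ge>k. p i \<noteq> (0::nat)"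
  shows "infinite {i::nat. p i \<noteq> 0}"
  using assms by (auto simp: infinite_nat_iff_unbounded_le)

lemma exists_mod_eq:
  assumes "y < n"
  shows "\<exists>i\<ge>k. i mod n = (y::nat)"
proof (intro exI conjI)
  show "k \<le> y + n * k" using assms by (cases n) auto
  show "(y + n * k) mod n = y" using assms by simp
qed

section \<open>Choice problems from retractions\<close>

text \<open>Stage \<open>i\<close> tests only the candidate \<open>i mod m\<close>: cycling avoids a
  search for the remaining candidate and still tests each one infinitely often.\<close>

definition missing_name :: "nat \<Rightarrow> baire \<Rightarrow> baire" where
  "missing_name m p = (\<lambda>i. if \<forall>z<m. z = i mod m \<or> (\<exists>j<Suc i. p j = Suc z) then Suc (i mod m) else 0)"

lemma computable_missing_name:
  assumes "0 < m"
  shows "computable (\<lambda>p. Some (missing_name m p))"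
proof (rule computableI)
  show "recursive 1 (\<lambda>p xs. missing_name m p (xs ! 0))"
    unfolding missing_name_def by (intro recursive_intros assms) simp_all
qed

text \<open>\<open>y\<close> is never excluded, so only stages with residue \<open>y\<close> can
  speak; once all other candidates are excluded, every such stage does.\<close>

lemma completion_missing_name_unique:
  assumes "{..<m} - range_minus_one p = {y}" "{..<m} \<subseteq> Y"
  shows "completion (nat_space Y) (missing_name m p) = Some (Some y)"
proof (rule completion_single_value)
  have "y < m" "y \<notin> range_minus_one p" using assms(1) by auto
  then have y: "y < m" "\<And>j. p j \<noteq> Suc y" by (simp_all add: range_minus_one_iff)
  show "y \<in> Y" using y assms(2) by auto
  show "missing_name m p i = Suc y" if "missing_name m p i \<noteq> 0" for i
  proof -
    have "y = i mod m \<or> (\<exists>j<Suc i. p j = Suc y)"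
      using that y(1) unfolding missing_name_def by meson
    then have "i mod m = y" using y(2) by blast
    then show ?thesis using that unfolding missing_name_def by presburger
  qed
  have "\<exists>j. p j = Suc z" if "z < m" "z \<noteq> y" for z
    using assms(1) that unfolding range_minus_one_iff[symmetric] by blast
  then obtain j where j: "\<And>z. z < m \<Longrightarrow> z \<noteq> y \<Longrightarrow> p (j z) = Suc z" by metis
  show "infinite {i. missing_name m p i \<noteq> 0}"
  proof (rule infinite_recurrent)
    fix k
    \<comment> \<open>From stage \<open>b\<close> on, every candidate other than \<open>y\<close>
      has been seen to be excluded.\<close>
    obtain b where b: "\<And>z. z < m \<Longrightarrow> j z \<le> b"
      using finite_nat_set_iff_bounded_le[of "j ` {..<m}"] by auto
    obtain i where i: "max k b \<le> i" "i mod m = y" using exists_mod_eq[OF y(1)] by blast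
    have "\<forall>z<m. z = i mod m \<or> (\<exists>j<Suc i. p j = Suc z)"
      using i j b by (metis le_imp_less_Suc max.bounded_iff order_trans)
    then show "\<exists>i\<ge>k. missing_name m p i \<noteq> 0"
      using i by (intro exI[of _ i]) (simp add: missing_name_def)
  qed
qed

text \<open>With at least two candidates, every stage needs the exclusion of another one, which
  never happens; the output stays silent forever.\<close>

lemma completion_missing_name_disjoint:
  assumes "{..<m} \<inter> range_minus_one p = {}" "2 \<le> m"
  shows "completion \<delta> (missing_name m p) = Some None"
proof (rule completion_zero)
  fix i
  have "\<exists>z<m. z \<noteq> i mod m"
    using assms(2) by (intro exI[of _ "if i mod m = 0 then 1 else 0"]) auto
  moreover have "p j \<noteq> Suc z" if "z < m" for j z
    using assms(1) that range_minus_one_iff[of z p] by blast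
  ultimately show "missing_name m p i = 0" by (auto simp: missing_name_def)
qed

text \<open>Unifies \<open>LLPO\<close> and \<open>AUC\<close>: for two candidates, the domain of choice allows at most one of them
  to be excluded.\<close>

lemma restricted_choice_sW_le_RET:
  assumes "2 \<le> m" "{..<m} \<subseteq> Y"
    and V: "\<And>p. V p \<noteq> {} \<Longrightarrow> V p = {..<m} - range_minus_one p \<and>
      (card ({..<m} - range_minus_one p) = 1 \<or> {..<m} \<inter> range_minus_one p = {})"
  shows "\<lparr>src = baire_space, tgt = nat_space {..<m}, vals = V\<rparr> \<le>\<^sub>s\<^sub>W RET (nat_space Y)"
\<comment> \<open>On the domain, a retraction onto a larger \<open>Y\<close> may return a number
  outside \<open>{..<m}\<close> only at \<bottom>; there every candidate is correct, and
  \<open>H\<close> picks 0.\<close>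
proof (rule sW_leI[where H = "\<lambda>r _. if r 0 < m then r 0 else 0" and K = "missing_name m"])
  show "computable (\<lambda>r. Some (\<lambda>_. if r 0 < m then r 0 else 0))"
    by (rule computableI) (intro recursive_intros)
  show "computable (\<lambda>p. Some (missing_name m p))"
    using assms(1) by (intro computable_missing_name) simp
  fix p x
  let ?f = "\<lparr>src = baire_space, tgt = nat_space {..<m}, vals = V\<rparr>"
  let ?cap = "\<lambda>r _. if r 0 < m then r 0 else (0::nat)"
  assume "src ?f p = Some x" "vals ?f x \<noteq> {}"
  then have [simp]: "x = p" and Vp: "V p = {..<m} - range_minus_one p"
    and "card ({..<m} - range_minus_one p) = 1 \<or> {..<m} \<inter> range_minus_one p = {}"
    using V[of x] by (auto simp: baire_space_def)
  from this(3)
  show "\<exists>x'. src (RET (nat_space Y)) (missing_name m p) = Some x' \<and> vals (RET (nat_space Y)) x' \<noteq> {} \<and>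
      (\<forall>r y. tgt (RET (nat_space Y)) r = Some y \<and> y \<in> vals (RET (nat_space Y)) x' \<longrightarrow>
         (\<exists>z. tgt ?f (?cap r) = Some z \<and> z \<in> vals ?f x))"
  proof
    assume "card ({..<m} - range_minus_one p) = 1"
    then obtain y where y: "{..<m} - range_minus_one p = {y}" by (auto simp: card_1_singleton_iff)
    then have "y < m" by auto
    then show ?thesis
      using y Vp completion_missing_name_unique[OF y assms(2)] assms(2)
      by (auto simp: RET_def ran_nat_space nat_space_eq_Some)
  next
    assume disj: "{..<m} \<inter> range_minus_one p = {}"
    then have "V p = {..<m}" using Vp by auto
    moreover have "0 \<in> Y" "0 < m" using assms(1,2) by auto
    ultimately show ?thesis
      using completion_missing_name_disjoint[OF disj assms(1), of "nat_space Y"]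
      by (auto simp: RET_def ran_nat_space nat_space_eq_Some)
  qed
qed

lemma LLPO_sW_le_RET:
  assumes "2 \<le> n"
  shows "LLPO \<le>\<^sub>s\<^sub>W RET (nat_space {..<n})"
  unfolding LLPO_def Choice_def
proof (rule restricted_choice_sW_le_RET)
  fix p assume ne: "{..<2} - range_minus_one p \<noteq> {}"
  have two: "{..<2} = {0, 1 :: nat}" by auto
  from ne show "{..<2} - range_minus_one p = {..<2} - range_minus_one p \<and>
      (card ({..<2} - range_minus_one p) = 1 \<or> {..<2} \<inter> range_minus_one p = {})"
    by (cases "0 \<in> range_minus_one p"; cases "1 \<in> range_minus_one p")
      (simp_all add: two insert_Diff_if)
next
  show "{..<2} \<subseteq> {..<n}" using assms by auto
qed simp

lemma AUC_sW_le_RET: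
  assumes "2 \<le> n"
  shows "AUC {..<n} \<le>\<^sub>s\<^sub>W RET (nat_space {..<n})"
  unfolding AUC_def
proof (rule restricted_choice_sW_le_RET)
  fix p
  let ?S = "{..<n} - range_minus_one p"
  assume "(if card ?S = 1 \<or> range_minus_one p = {} then ?S else {}) \<noteq> {}"
  then have "card ?S = 1 \<or> range_minus_one p = {}"
    by presburger
  then show "(if card ?S = 1 \<or> range_minus_one p = {} then ?S else {}) = ?S \<and>
      (card ?S = 1 \<or> {..<n} \<inter> range_minus_one p = {})"
    by (elim disjE) simp_all
qed (rule assms subset_refl)+

text \<open>The two problems agree on the smaller domain of \<open>AUC X\<close>, so both
  translations are the identity.\<close>

lemma AUC_sW_le_Choice: "AUC X \<le>\<^sub>s\<^sub>W Choice X"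
  by (rule sW_leI[where H = "\<lambda>r. r" and K = "\<lambda>p. p"])
    (auto simp: computable_id AUC_def Choice_def split: if_splits)

text \<open>A name of a point below \<open>n\<close> denotes the same point in the larger
  completion. Any other name denotes \<bottom> in the smaller one, where each answer below
  \<open>n\<close> is correct; answers not below \<open>n\<close> become 0.\<close>

lemma RET_sW_le_RET_UNIV:
  assumes "0 < n"
  shows "RET (nat_space {..<n}) \<le>\<^sub>s\<^sub>W RET (nat_space UNIV)"
proof (rule sW_leI[where H = "\<lambda>r _. if r 0 < n then r 0 else 0" and K = "\<lambda>p. p"])
  show "computable (\<lambda>r. Some (\<lambda>_. if r 0 < n then r 0 else 0))"
    by (rule computableI) (intro recursive_intros)
qed (use assms in \<open>auto simp: computable_id RET_def completion_nat_space ran_nat_space nat_space_eq_Some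
      split: if_splits\<close>)

section \<open>The search for the first nonzero entry\<close>

text \<open>A total, stagewise version of \<open>LEAST j. p j \<noteq> 0\<close>: as long as
  \<open>p 0, ..., p i\<close> are zero it returns \<open>i\<close> itself, so the value of
  \<open>p\<close> at the result tells whether an entry has been found.\<close>

fun first_nonzero :: "baire \<Rightarrow> nat \<Rightarrow> nat" where
  "first_nonzero p 0 = 0"
| "first_nonzero p (Suc i) = (if p (first_nonzero p i) \<noteq> 0 then first_nonzero p i else Suc i)"

lemma first_nonzero_before: "(\<And>j. j \<le> i \<Longrightarrow> p j = 0) \<Longrightarrow> first_nonzero p i = i"
  by (induction i) auto

lemma first_nonzero_eq:
  assumes "p i \<noteq> 0" "\<And>j. j < i \<Longrightarrow> p j = 0" "i \<le> k"
  shows "first_nonzero p k = i"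
  using assms(3)
proof (induction k)
  case (Suc k)
  show ?case
  proof (cases "i \<le> k")
    case False
    with Suc.prems have "i = Suc k" by simp
    with assms(2) first_nonzero_before[of k p] show ?thesis by simp
  qed (use Suc.IH assms(1) in simp)
qed simp

lemma recursive_first_nonzero:
  assumes "recursive k f"
  shows "recursive k (\<lambda>p xs. first_nonzero p (f p xs))"
proof -
  have "recursive k (\<lambda>p xs. rec_nat 0 (\<lambda>i r. if p r \<noteq> 0 then r else Suc i) (f p xs))"
    by (intro recursive_rec_nat recursive_intros assms) simp_all
  moreover have "rec_nat 0 (\<lambda>i r. if p r \<noteq> 0 then r else Suc i) n = first_nonzero p n" for p n
    by (induction n) simp_all
  ultimately show ?thesis by simp
qed

lemma first_nonzero_eq_Least:
  assumes "p j \<noteq> 0" "(LEAST j. p j \<noteq> 0) \<le> k"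
  shows "first_nonzero p k = (LEAST j. p j \<noteq> 0)"
  using LeastI[of "\<lambda>j. p j \<noteq> 0", OF assms(1)] not_less_Least[of _ "\<lambda>j. p j \<noteq> 0"] assms(2)
  by (intro first_nonzero_eq) blast+

lemma first_nonzero_zero_or_Least:
  "p (first_nonzero p i) = 0 \<or> (\<exists>j. p j \<noteq> 0) \<and> first_nonzero p i = (LEAST j. p j \<noteq> 0)"
proof (cases "\<exists>j\<le>i. p j \<noteq> 0")
  case True
  then obtain j where j: "j \<le> i" "p j \<noteq> 0" by blast
  have "(LEAST j. p j \<noteq> 0) \<le> i"
    using Least_le[of "\<lambda>j. p j \<noteq> 0", OF j(2)] j(1) by (rule le_trans)
  with first_nonzero_eq_Least[of p j, OF j(2)] j(2) show ?thesis by blast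
next
  case False
  with first_nonzero_before[of i p] show ?thesis by (metis order_refl)
qed

lemma infinite_first_nonzero:
  assumes "p j \<noteq> 0"
  shows "infinite {i. p (first_nonzero p i) \<noteq> 0}"
proof (rule infinite_recurrent)
  fix k
  let ?l = "LEAST j. p j \<noteq> 0"
  have "p ?l \<noteq> 0" using LeastI[of "\<lambda>j. p j \<noteq> 0", OF assms] .
  then have "p (first_nonzero p (max ?l k)) \<noteq> 0"
    by (subst first_nonzero_eq_Least[of p j, OF assms max.cobounded1])
  then show "\<exists>i\<ge>k. p (first_nonzero p i) \<noteq> 0"
    using max.cobounded2 by blast
qed

section \<open>Retraction from all-or-unique choice\<close>

text \<open>The residues \<open>i mod n\<close> run through all candidates, and all but the one
  named by the first nonzero entry get excluded. An entry above \<open>n\<close> names no candidate;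
  silence then prevents the exclusion of all of them, which would leave the domain of
  \<open>AUC\<close>.\<close>

definition others_name :: "nat \<Rightarrow> baire \<Rightarrow> baire" where
  "others_name n p = (\<lambda>i. if p (first_nonzero p i) = 0 \<or> n < p (first_nonzero p i) \<or>
      p (first_nonzero p i) = Suc (i mod n) then 0 else Suc (i mod n))"

lemma range_others_name:
  assumes "y < n" "p l = Suc y" "\<And>j. j < l \<Longrightarrow> p j = 0"
  shows "range_minus_one (others_name n p) = {..<n} - {y}"
proof (rule set_eqI)
  fix z
  have ge: "first_nonzero p i = l" if "l \<le> i" for i
    using assms(2,3) that by (intro first_nonzero_eq) auto
  have lt: "p (first_nonzero p i) = 0" if "i < l" for i
    using that assms(3) first_nonzero_before[of i p] by simp
  show "z \<in> range_minus_one (others_name n p) \<longleftrightarrow> z \<in> {..<n} - {y}"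
  proof
    assume "z \<in> range_minus_one (others_name n p)"
    then obtain i where i: "others_name n p i = Suc z" by (auto simp: range_minus_one_iff)
    then have "l \<le> i" using lt[of i] by (force simp: others_name_def)
    then show "z \<in> {..<n} - {y}"
      using i assms(1,2) ge[of i] by (auto simp: others_name_def split: if_splits)
  next
    assume z: "z \<in> {..<n} - {y}"
    then obtain i where "l \<le> i" "i mod n = z" using exists_mod_eq[of z n l] by auto
    then have "others_name n p i = Suc z"
      using z assms(1,2) ge[of i] by (auto simp: others_name_def)
    then show "z \<in> range_minus_one (others_name n p)" by (auto simp: range_minus_one_iff)
  qed
qed

lemma range_others_name_empty:
  assumes "\<And>i. p (first_nonzero p i) = 0 \<or> n < p (first_nonzero p i)"
  shows "range_minus_one (others_name n p) = {}"
proof -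
  have "others_name n p i = 0" for i
    using assms[of i] by (auto simp: others_name_def)
  then show ?thesis by (auto simp: range_minus_one_iff)
qed

text \<open>A first nonzero entry \<open>Suc y\<close> with \<open>y < n\<close> leaves
  \<open>y\<close> as the only solution, which is correct even if \<open>p - 1\<close> is finite and
  \<open>p\<close> denotes \<bottom>. Otherwise nothing is excluded and \<open>p\<close> denotes
  \<bottom>, so any answer is correct.\<close>

lemma RET_sW_le_AUC:
  assumes "0 < n"
  shows "RET (nat_space {..<n}) \<le>\<^sub>s\<^sub>W AUC {..<n}"
proof (rule sW_leI[where H = "\<lambda>r. r" and K = "others_name n"])
  show "computable (\<lambda>p. Some (others_name n p))"
    by (rule computableI, unfold others_name_def)
      (intro recursive_intros recursive_first_nonzero assms; simp)
  fix p :: baire and x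
  define l where "l = (LEAST j. p j \<noteq> 0)"
  assume "src (RET (nat_space {..<n})) p = Some x"
  then have x: "(if infinite {i. p i \<noteq> 0} \<and> p l - 1 < n then Some (p l - 1) else None) = x"
    unfolding l_def RET_def completion_nat_space by (simp only: problem.simps option.inject lessThan_iff)
  show "\<exists>x'. src (AUC {..<n}) (others_name n p) = Some x' \<and> vals (AUC {..<n}) x' \<noteq> {} \<and>
      (\<forall>r y. tgt (AUC {..<n}) r = Some y \<and> y \<in> vals (AUC {..<n}) x' \<longrightarrow>
         (\<exists>z. tgt (RET (nat_space {..<n})) r = Some z \<and> z \<in> vals (RET (nat_space {..<n})) x))"
  proof (cases "p l \<noteq> 0 \<and> p l \<le> n")
    case True
    then obtain y where y: "p l = Suc y" "y < n" by (cases "p l") auto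
    have before: "p j = 0" if "j < l" for j
      using not_less_Least that unfolding l_def by blast
    have "range_minus_one (others_name n p) = {..<n} - {y}"
      by (intro range_others_name[of y n p l] y before)
    moreover have "{..<n} - ({..<n} - {y}) = {y}" using y by auto
    moreover have "x = Some y \<or> x = None" using x y by (auto split: if_splits)
    ultimately show ?thesis using y(2)
      by (auto simp: AUC_def RET_def baire_space_def ran_nat_space nat_space_eq_Some)
  next
    case False
    have "range_minus_one (others_name n p) = {}"
      using False first_nonzero_zero_or_Least[of p, folded l_def]
      by (intro range_others_name_empty) (metis not_le)
    moreover have "x = None"
    proof (cases "p l = 0")
      case True
      \<comment> \<open>By \<open>LeastI\<close>, any nonzero entry would make \<open>p l\<close>
        nonzero.\<close>
      then have "{i. p i \<noteq> 0} = {}"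
        using LeastI[of "\<lambda>j. p j \<noteq> 0"] unfolding l_def by blast
      then show ?thesis using x by (simp only: finite.emptyI simp_thms if_False)
    qed (use False x in auto)
    ultimately show ?thesis using assms
      by (auto simp: AUC_def RET_def baire_space_def ran_nat_space nat_space_eq_Some)
  qed
qed (simp_all add: computable_id)

section \<open>Retraction onto the natural numbers and \<open>LPO\<close>\<close>

text \<open>\<open>H\<close> also receives the original name, to read the entry at the position
  found. Decreased by one, it is the retracted point if \<open>p - 1\<close> is infinite; if not,
  any number will do. On a correct answer the search terminates, since 0 guarantees a nonzero
  entry.\<close>

lemma RET_W_le_LPO: "RET (nat_space UNIV) \<le>\<^sub>W LPO"
proof -
  \<comment> \<open>\<open>s 1\<close> is the answer of \<open>LPO\<close>, and
    \<open>s (2 * i)\<close> is \<open>p i\<close>.\<close>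
  let ?P = "\<lambda>s i. s 1 \<noteq> 0 \<or> s (2 * i) \<noteq> (0::nat)"
  \<comment> \<open>Both answers of \<open>LPO\<close> are handled by one search: on answer 1 it stops at position 0 of the
    zero sequence, where the value \<open>0 - 1 = 0\<close> is harmless.\<close>
  let ?H = "\<lambda>s. if \<exists>i. ?P s i then Some (\<lambda>_::nat. s (2 * (LEAST i. ?P s i)) - 1) else None"
  show ?thesis
  proof (rule W_leI[where H = ?H and K = "\<lambda>p. p"])
    show "computable ?H"
      by (rule computable_search) (intro recursive_intros; simp)+
    fix p x
    assume x: "src (RET (nat_space UNIV)) p = Some x"
    show "\<exists>x'. src LPO p = Some x' \<and> vals LPO x' \<noteq> {} \<and>
      (\<forall>r y. tgt LPO r = Some y \<and> y \<in> vals LPO x' \<longrightarrow>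
         (\<exists>q z. ?H (pairing p r) = Some q \<and> tgt (RET (nat_space UNIV)) q = Some z \<and>
           z \<in> vals (RET (nat_space UNIV)) x))"
    proof (cases "\<forall>i. p i = 0")
      case True
      then show ?thesis using x
        by (auto simp: LPO_def RET_def baire_space_def completion_zero ran_nat_space nat_space_eq_Some)
    next
      case False
      then show ?thesis using x
        by (auto simp: LPO_def RET_def baire_space_def completion_nat_space ran_nat_space nat_space_eq_Some
            split: if_splits)
    qed
  qed (simp add: computable_id)
qed

lemma LPO_W_le_RET: "LPO \<le>\<^sub>W RET (nat_space UNIV)"
proof -
  \<comment> \<open>The shift by \<open>Suc\<close> keeps a first nonzero entry at position 0 from
    being read as silence.\<close>
  let ?K = "\<lambda>p i. if p (first_nonzero p i) = 0 then 0 else Suc (first_nonzero p i)"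
  \<comment> \<open>\<open>s 1\<close> is the returned position \<open>j\<close>, and
    \<open>s (2 * s 1)\<close> is \<open>p j\<close>. On the zero sequence every \<open>j\<close>
    yields 0; otherwise \<open>j\<close> is the position of the first nonzero entry.\<close>
  let ?H = "\<lambda>s _::nat. if s (2 * s 1) = 0 then 1 else 0 :: nat"
  show ?thesis
  proof (rule W_leI[where H = "\<lambda>s. Some (?H s)" and K = ?K])
    show "computable (\<lambda>s. Some (?H s))"
      by (rule computableI) (intro recursive_intros)
    show "computable (\<lambda>p. Some (?K p))"
      by (rule computableI) (intro recursive_intros recursive_first_nonzero; simp)
    fix p x
    assume "src LPO p = Some x"
    then have [simp]: "x = p" by (simp add: LPO_def baire_space_def)
    show "\<exists>x'. src (RET (nat_space UNIV)) (?K p) = Some x' \<and> vals (RET (nat_space UNIV)) x' \<noteq> {} \<and>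
      (\<forall>r y. tgt (RET (nat_space UNIV)) r = Some y \<and> y \<in> vals (RET (nat_space UNIV)) x' \<longrightarrow>
         (\<exists>q z. Some (?H (pairing p r)) = Some q \<and> tgt LPO q = Some z \<and> z \<in> vals LPO x))"
    proof (cases "\<forall>i. p i = 0")
      case True
      then show ?thesis
        by (auto simp: LPO_def RET_def completion_zero ran_nat_space nat_space_eq_Some)
    next
      case False
      then obtain j where j: "p j \<noteq> 0" by blast
      define l where "l = (LEAST j. p j \<noteq> 0)"
      have "p l \<noteq> 0" using LeastI[of "\<lambda>j. p j \<noteq> 0", OF j] unfolding l_def .
      moreover have "completion (nat_space UNIV) (?K p) = Some (Some l)"
      proof (rule completion_single_value)
        show "infinite {i. ?K p i \<noteq> 0}"
          using infinite_first_nonzero[of p, OF j] by simp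
        show "?K p i = Suc l" if "?K p i \<noteq> 0" for i
          using that first_nonzero_zero_or_Least[of p i, folded l_def] by (metis (full_types))
      qed simp
      ultimately show ?thesis
        using False by (auto simp: LPO_def RET_def ran_nat_space nat_space_eq_Some)
    qed
  qed
qed

theorem proposition7p8:
  fixes n :: nat
  assumes "n \<ge> 2"
  shows "LLPO \<le>\<^sub>s\<^sub>W RET (nat_space {..<n}) \<and>
         RET (nat_space {..<n}) \<equiv>\<^sub>s\<^sub>W AUC {..<n} \<and>
         AUC {..<n} \<le>\<^sub>s\<^sub>W Choice {..<n} \<and>
         RET (nat_space {..<n}) \<le>\<^sub>s\<^sub>W RET (nat_space UNIV) \<and>
         RET (nat_space UNIV) \<equiv>\<^sub>W LPO"
  using assms
  by (simp add: sW_eq_def W_eq_def LLPO_sW_le_RET RET_sW_le_AUC AUC_sW_le_RET AUC_sW_le_Choice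
      RET_sW_le_RET_UNIV RET_W_le_LPO LPO_W_le_RET)

end
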